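(* Let $A$ be an arbitrary-dimensional evolution $\mathbb{K}$-algebra with natural basis $B$ and let $E$ be its associated directed graph relative to $B$. Assume that $E$ contains finitely many bifurcations. Then $A$ is finitely generated as an algebra if and only if $E^0=\overline{S}$ for some finite subset $S\subset E^0$.
   Context: An evolution algebra over a field $\mathbb{K}$ is a (not necessarily associative or finite-dimensional) $\mathbb{K}$-algebra $A$ having a basis $B=\{e_i\}_{i\in\Lambda}$, called a natural basis, with $e_ie_j=0$ whenever $i\neq j$. The associated directed graph $E$ relative to $B$ has vertex set $E^0=B$ and exactly one edge from $e_i$ to $e_j$ if the coefficient of $e_j$ in $e_i^2$ is nonzero, and no edge otherwise. A vertex $u$ is a bifurcation (vertex) if at least two edges have source $u$; "finitely many bifurcations" means finitely many bifurcation vertices. A subset $H\subset E^0$ is hereditary if, for every $u\in H$, every vertex reachable from $u$ by a directed path belongs to $H$. The hereditary closure $\overline{S}$ of $S\subset E^0$ is the smallest hereditary subset of $E^0$ containing $S$. *)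

theory Defs
  imports Main "HOL.Vector_Spaces"
begin

section \<open>Directed graphs\<close>

text \<open>
  The graphs below have at most one edge from one vertex to another, so the edge set is a
  relation \<open>E\<close> on the vertex set \<open>V\<close>: the pair \<open>(u, v)\<close> is the edge with source \<open>u\<close> and target
  \<open>v\<close>, and \<open>v\<close> is reachable from \<open>u\<close> by a directed path iff \<open>(u, v) \<in> E\<^sup>*\<close>.
\<close>

definition bifurcations :: "'a set \<Rightarrow> 'a rel \<Rightarrow> 'a set" where
  "bifurcations V E =
     {u \<in> V. \<exists>e\<in>E. \<exists>e'\<in>E. e \<noteq> e' \<and> fst e = u \<and> fst e' = u}"

definition hereditary :: "'a set \<Rightarrow> 'a rel \<Rightarrow> 'a set \<Rightarrow> bool" where
  "hereditary V E H \<longleftrightarrow> H \<subseteq> V \<and> (\<forall>u\<in>H. \<forall>v. (u, v) \<in> E\<^sup>* \<longrightarrow> v \<in> H)"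

definition hereditary_closure :: "'a set \<Rightarrow> 'a rel \<Rightarrow> 'a set \<Rightarrow> 'a set" where
  "hereditary_closure V E S = hereditary V E hull S"

lemma hereditary_hereditary_closure:
  assumes "E \<subseteq> V \<times> V" "S \<subseteq> V"
  shows "hereditary V E (hereditary_closure V E S)"
proof -
  have "v \<in> V" if "(u, v) \<in> E\<^sup>*" "u \<in> V" for u v
    using that assms(1) by (induction rule: rtrancl_induct) auto
  then have "hereditary V E V"
    by (auto simp: hereditary_def)
  with assms(2) show ?thesis
    unfolding hereditary_closure_def hull_def hereditary_def by blast
qed


section \<open>Algebras\<close>

text \<open>Neither associativity, commutativity, a unit nor finite dimension is assumed.\<close>

locale algebra = vector_space scale
  for scale :: "'k::field \<Rightarrow> 'a::ab_group_add \<Rightarrow> 'a"  (infixr \<open>*s\<close> 75) +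
  fixes mult :: "'a \<Rightarrow> 'a \<Rightarrow> 'a"  (infixl \<open>\<bullet>\<close> 70)
  assumes mult_add_left: "(x + y) \<bullet> z = x \<bullet> z + y \<bullet> z"
    and mult_add_right: "x \<bullet> (y + z) = x \<bullet> y + x \<bullet> z"
    and mult_scale_left: "(c *s x) \<bullet> y = c *s (x \<bullet> y)"
    and mult_scale_right: "x \<bullet> (c *s y) = c *s (x \<bullet> y)"
begin

definition subalgebra :: "'a set \<Rightarrow> bool" where
  "subalgebra T \<longleftrightarrow> subspace T \<and> (\<forall>x\<in>T. \<forall>y\<in>T. x \<bullet> y \<in> T)"

definition finitely_generated :: bool where
  "finitely_generated \<longleftrightarrow> (\<exists>X. finite X \<and> subalgebra hull X = UNIV)"

lemma subalgebra_hull: "subalgebra (subalgebra hull X)"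
  by (rule hull_in) (auto simp: subalgebra_def intro: subspace_Inter)

end


section \<open>Evolution algebras\<close>

locale evolution_algebra = algebra scale mult
  for scale :: "'k::field \<Rightarrow> 'a::ab_group_add \<Rightarrow> 'a"  (infixr \<open>*s\<close> 75)
    and mult :: "'a \<Rightarrow> 'a \<Rightarrow> 'a"  (infixl \<open>\<bullet>\<close> 70) +
  fixes B :: "'a set"
  assumes independent_basis: "independent B"
    and span_basis: "span B = UNIV"
    and natural_basis: "\<lbrakk>e \<in> B; e' \<in> B; e \<noteq> e'\<rbrakk> \<Longrightarrow> e \<bullet> e' = 0"
begin

text \<open>The edges of the graph associated with \<open>B\<close>; its vertex set is \<open>B\<close> itself.\<close>

definition edges :: "'a rel" where
  "edges = {(u, v). u \<in> B \<and> v \<in> B \<and> representation B (u \<bullet> u) v \<noteq> 0}"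

end

end

theory Submission
  imports Defs
begin

text \<open>
  Subspaces spanned by hereditary sets of vertices are subalgebras, and conversely the vertices
  lying in a subalgebra form a set that is almost hereditary: an edge can leave it only at a
  bifurcation.

  If a finite set generates the algebra, then the finitely many vertices in the supports of
  the generators have a hereditary closure whose span is a subalgebra containing the generators
  (\<open>subalgebra_span_hereditary\<close>), so this span is everything and linear independence forces the
  closure to be the whole basis.

  For the other direction, the square of a vertex \<open>u\<close> that is not a bifurcation is a nonzero
  multiple of the only vertex \<open>v\<close> that \<open>u\<close> points to, so a subalgebra containing \<open>u\<close> contains
  \<open>v\<close> (\<open>edge_target_in_subalgebra\<close>). At a bifurcation the square only gives one combination of
  several vertices. Adding all these targets to \<open>S\<close> repairs this, and the enlarged set is still
  finite, because there are finitely many bifurcations and every vertex has finitely many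
  successors.
\<close>

context evolution_algebra
begin

lemma in_span_support: "x \<in> span {b. representation B x b \<noteq> 0}"
proof -
  have "x = (\<Sum>b | representation B x b \<noteq> 0. representation B x b *s b)"
    using sum_nonzero_representation_eq[OF independent_basis, of x] span_basis by simp
  also have "\<dots> \<in> span {b. representation B x b \<noteq> 0}"
    by (intro span_sum span_scale span_base)
  finally show ?thesis .
qed

lemma finite_successors: "finite (edges `` {u})"
proof (rule finite_subset)
  show "edges `` {u} \<subseteq> {b. representation B (u \<bullet> u) b \<noteq> 0}"
    by (auto simp: edges_def)
qed (rule finite_representation)

lemma zero_mult: "0 \<bullet> x = 0"
  using mult_scale_left[of 0 0 x] by simp

lemma mult_zero: "x \<bullet> 0 = 0"
  using mult_scale_right[of x 0 0] by simp

text \<open>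
  Products of distinct vertices vanish, and the square of a vertex is supported on its
  successors.
\<close>

lemma subalgebra_span_hereditary:
  assumes "hereditary B edges H"
  shows "subalgebra (span H)"
proof -
  have HB: "H \<subseteq> B" and closed: "\<And>u v. u \<in> H \<Longrightarrow> (u, v) \<in> edges \<Longrightarrow> v \<in> H"
    using assms by (auto simp: hereditary_def)
  have vertices: "u \<bullet> v \<in> span H" if "u \<in> H" "v \<in> H" for u v
  proof (cases "u = v")
    case True
    have "{b. representation B (u \<bullet> u) b \<noteq> 0} \<subseteq> H"
    proof
      fix b assume b: "b \<in> {b. representation B (u \<bullet> u) b \<noteq> 0}"
      then have "b \<in> B"
        using representation_ne_zero by blast
      with b that HB have "(u, b) \<in> edges"
        by (auto simp: edges_def)
      with that closed show "b \<in> H"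
        by blast
    qed
    with in_span_support[of "u \<bullet> u"] show ?thesis
      unfolding True[symmetric] using span_mono by blast
  next
    case False
    with that HB natural_basis have "u \<bullet> v = 0"
      by blast
    then show ?thesis
      by (simp add: span_zero)
  qed
  have vertex_left: "u \<bullet> y \<in> span H" if "u \<in> H" "y \<in> span H" for u y
    using that(2)
  proof (induction rule: span_induct_alt)
    case base
    show ?case by (simp add: mult_zero span_zero)
  next
    case (step c v y)
    then show ?case
      using vertices[OF that(1)] by (simp add: mult_add_right mult_scale_right span_add span_scale)
  qed
  have "x \<bullet> y \<in> span H" if "x \<in> span H" "y \<in> span H" for x y
    using that(1)
  proof (induction rule: span_induct_alt)
    case base
    show ?case by (simp add: zero_mult span_zero)
  next
    case (step c u x)
    then show ?case
      using vertex_left[OF _ that(2)]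
      by (simp add: mult_add_left mult_scale_left span_add span_scale)
  qed
  then show ?thesis
    by (simp add: subalgebra_def)
qed

text \<open>A vertex \<open>u\<close> that is not a bifurcation has \<open>v\<close> as its only successor, so \<open>v\<close> is a scalar multiple of \<open>u \<bullet> u\<close>.\<close>

lemma edge_target_in_subalgebra:
  assumes "subalgebra T" "u \<in> T" "(u, v) \<in> edges" "u \<notin> bifurcations B edges"
  shows "v \<in> T"
proof -
  let ?c = "representation B (u \<bullet> u)"
  have uv: "u \<in> B" "v \<in> B" "?c v \<noteq> 0"
    using assms(3) by (auto simp: edges_def)
  have "w = v" if "?c w \<noteq> 0" for w
  proof (rule ccontr)
    assume "w \<noteq> v"
    moreover have "(u, w) \<in> edges"
      using that uv(1) representation_ne_zero by (auto simp: edges_def)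
    ultimately have "u \<in> bifurcations B edges"
      using assms(3) uv(1) unfolding bifurcations_def by force
    with assms(4) show False ..
  qed
  with uv(3) have "{w. ?c w \<noteq> 0} = {v}"
    by blast
  then have "u \<bullet> u = ?c v *s v"
    using sum_nonzero_representation_eq[OF independent_basis, of "u \<bullet> u"] span_basis by simp
  then have "inverse (?c v) *s (u \<bullet> u) = inverse (?c v) *s (?c v *s v)"
    by (rule arg_cong)
  also have "\<dots> = v"
    using uv(3) by simp
  finally have "inverse (?c v) *s (u \<bullet> u) = v" .
  moreover have "inverse (?c v) *s (u \<bullet> u) \<in> T"
    using assms(1,2) by (simp add: subalgebra_def subspace_scale)
  ultimately show ?thesis
    by simp
qed

lemma finite_hereditary_generators:
  assumes "finitely_generated"
  obtains S where "finite S" "S \<subseteq> B" "B = hereditary_closure B edges S"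
proof -
  obtain X where X: "finite X" "subalgebra hull X = UNIV"
    using assms by (auto simp: finitely_generated_def)
  define S where "S = (\<Union>x\<in>X. {b. representation B x b \<noteq> 0})"
  have "finite S"
    using X(1) by (simp add: S_def finite_representation)
  have "S \<subseteq> B"
    by (auto simp: S_def intro: representation_ne_zero)
  define H where "H = hereditary_closure B edges S"
  have her: "hereditary B edges H"
    unfolding H_def
    by (rule hereditary_hereditary_closure[OF _ \<open>S \<subseteq> B\<close>]) (auto simp: edges_def)
  then have "H \<subseteq> B"
    by (simp add: hereditary_def)
  have "S \<subseteq> H"
    unfolding H_def hereditary_closure_def by (rule hull_subset)
  have "X \<subseteq> span H"
  proof
    fix x assume "x \<in> X"
    then have "{b. representation B x b \<noteq> 0} \<subseteq> H"
      using \<open>S \<subseteq> H\<close> by (auto simp: S_def)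
    then show "x \<in> span H"
      using in_span_support span_mono by blast
  qed
  then have "subalgebra hull X \<subseteq> span H"
    by (rule hull_minimal) (rule subalgebra_span_hereditary[OF her])
  with X(2) have span_H: "span H = UNIV"
    by blast
  have "B \<subseteq> H"
  proof
    fix b assume "b \<in> B"
    show "b \<in> H"
    proof (rule ccontr)
      assume "b \<notin> H"
      with \<open>H \<subseteq> B\<close> have "H \<subseteq> B - {b}"
        by blast
      with span_H have "b \<in> span (B - {b})"
        using span_mono by blast
      with \<open>b \<in> B\<close> independent_basis show False
        by (auto simp: dependent_def)
    qed
  qed
  with \<open>H \<subseteq> B\<close> have "B = hereditary_closure B edges S"
    unfolding H_def by (rule subset_antisym[rotated])
  with \<open>finite S\<close> \<open>S \<subseteq> B\<close> show thesis
    by (rule that)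
qed

lemma finitely_generated_if_finite_bifurcations:
  assumes "finite (bifurcations B edges)" "finite S" "S \<subseteq> B"
    and B: "B = hereditary_closure B edges S"
  shows "finitely_generated"
proof -
  \<comment> \<open>With the targets of the bifurcations among the generators, no edge leaves \<open>B \<inter> T\<close>.\<close>
  define X where "X = S \<union> (\<Union>u \<in> bifurcations B edges. edges `` {u})"
  define T where "T = subalgebra hull X"
  have "finite X"
    using assms(1,2) by (simp add: X_def finite_successors)
  have T: "subalgebra T"
    unfolding T_def by (rule subalgebra_hull)
  have "X \<subseteq> T"
    unfolding T_def by (rule hull_subset)
  have edge: "v \<in> B \<inter> T" if "u \<in> B \<inter> T" "(u, v) \<in> edges" for u v
  proof (cases "u \<in> bifurcations B edges")
    case True
    with that(2) have "v \<in> X"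
      by (auto simp: X_def)
    with \<open>X \<subseteq> T\<close> that(2) show ?thesis
      by (auto simp: edges_def)
  next
    case False
    with edge_target_in_subalgebra[OF T _ that(2)] that show ?thesis
      by (auto simp: edges_def)
  qed
  have path: "v \<in> B \<inter> T" if "(u, v) \<in> edges\<^sup>*" "u \<in> B \<inter> T" for u v
    using that by (induction rule: rtrancl_induct) (assumption, rule edge)
  have "hereditary B edges (B \<inter> T)"
    unfolding hereditary_def using path by blast
  moreover have "S \<subseteq> B \<inter> T"
    using \<open>S \<subseteq> B\<close> \<open>X \<subseteq> T\<close> by (auto simp: X_def)
  ultimately have "hereditary_closure B edges S \<subseteq> B \<inter> T"
    unfolding hereditary_closure_def by (intro hull_minimal)
  with B have "B \<subseteq> T"
    by blast
  then have "span B \<subseteq> T"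
    using T by (intro span_minimal) (simp_all add: subalgebra_def)
  with span_basis have "T = UNIV"
    by blast
  with \<open>finite X\<close> show ?thesis
    by (auto simp: finitely_generated_def T_def)
qed

end

theorem proposition4p3:
  fixes scale :: "'k::field \<Rightarrow> 'a::ab_group_add \<Rightarrow> 'a"
    and mult :: "'a \<Rightarrow> 'a \<Rightarrow> 'a"
    and B :: "'a set"
  defines "E \<equiv> evolution_algebra.edges scale mult B"
  assumes "evolution_algebra scale mult B"
    and "finite (bifurcations B E)"
  shows "algebra.finitely_generated scale mult \<longleftrightarrow>
         (\<exists>S. finite S \<and> S \<subseteq> B \<and> B = hereditary_closure B E S)"
proof -
  interpret evolution_algebra scale mult B
    by fact
  have fin: "finite (bifurcations B edges)"
    using assms(3) by (simp only: E_def)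
  show ?thesis
    unfolding E_def
  proof
    assume "finitely_generated"
    then obtain S where "finite S" "S \<subseteq> B" "B = hereditary_closure B edges S"
      by (rule finite_hereditary_generators)
    then show "\<exists>S. finite S \<and> S \<subseteq> B \<and> B = hereditary_closure B edges S"
      by (intro exI conjI)
  next
    assume "\<exists>S. finite S \<and> S \<subseteq> B \<and> B = hereditary_closure B edges S"
    then show "finitely_generated"
      by (elim exE conjE) (rule finitely_generated_if_finite_bifurcations[OF fin])
  qed
qed

end
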